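(* Let $G$ be a graph of order $n\ge 2$. Then: (a) $\mathrm{Sd}_f(G,\overline{G})=1$ if and only if $G$ is isomorphic to one of $P_2,\overline{P}_2,P_3,\overline{P}_3$; (b) $\mathrm{Sd}_f(G,\overline{G})=\frac{n}{2}$ if and only if each vertex of $G$ belongs to a twin equivalence class of $G$ of cardinality at least two.
   Context: Graphs are finite, simple and undirected, and need not be connected. $\overline{G}$ is the complement of $G$ (on the same vertex set), and $P_n$ is the path on $n$ vertices. $d_G(x,y)$ is the least number of edges on a path joining $x$ and $y$ in $G$ ($\infty$ if there is none). For distinct $x,y\in V(G)$, $R_G\{x,y\}=\{z\in V(G): d_G(x,z)\ne d_G(y,z)\}$. For a function $g$ on $V$ and $U\subseteq V$, $g(U)=\sum_{s\in U}g(s)$. A resolving function of $G$ is a function $g:V(G)\to[0,1]$ with $g(R_G\{x,y\})\ge 1$ for all distinct $x,y\in V(G)$. $\mathrm{Sd}_f(G,\overline{G})$ is the minimum of $g(V(G))$ over all functions $g:V(G)\to[0,1]$ that are resolving functions of both $G$ and $\overline{G}$. With $N_G(v)$ the open neighborhood of $v$, two vertices $u,w$ of $G$ are twins if $N_G(u)-\{w\}=N_G(w)-\{u\}$ (every vertex is its own twin); this is an equivalence relation whose classes are the twin equivalence classes of $G$. *)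

theory Defs
  imports
    "HOL-Analysis.Analysis"
    "Graph_Theory.Pair_Digraph"
    "Graph_Theory.Digraph_Isomorphism"
begin

text \<open>
  A finite simple undirected graph is a \<open>pair_graph\<close>: a finite loop-free digraph whose arcs are
  ordered pairs and whose arc relation is symmetric, each undirected edge being represented by its
  two orientations. Isomorphism is \<open>digraph_iso\<close>.
\<close>

definition complement_graph :: "'a pair_pre_digraph \<Rightarrow> 'a pair_pre_digraph" where
  "complement_graph G =
    \<lparr> pverts = pverts G,
      parcs = {(u, v). u \<in> pverts G \<and> v \<in> pverts G \<and> u \<noteq> v \<and> (u, v) \<notin> parcs G} \<rparr>"

definition path_graph :: "nat \<Rightarrow> nat pair_pre_digraph" where
  "path_graph n =
    \<lparr> pverts = {0..<n},
      parcs = {(i, j). i < n \<and> j < n \<and> (j = Suc i \<or> i = Suc j)} \<rparr>"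

text \<open>
  \<open>apath x p y\<close> says that the arc list \<open>p\<close> is a path (no repeated vertex) from \<open>x\<close> to \<open>y\<close>. The
  infimum is a minimum since \<^typ>\<open>enat\<close> is well-ordered, and it is \<open>\<infinity>\<close> when there is no path.
\<close>

definition graph_dist :: "'a pair_pre_digraph \<Rightarrow> 'a \<Rightarrow> 'a \<Rightarrow> enat" where
  "graph_dist G x y = (INF p \<in> {p. pre_digraph.apath (with_proj G) x p y}. enat (length p))"

definition resolving_set :: "'a pair_pre_digraph \<Rightarrow> 'a \<Rightarrow> 'a \<Rightarrow> 'a set" where
  "resolving_set G x y = {z \<in> pverts G. graph_dist G x z \<noteq> graph_dist G y z}"

text \<open>
  Only the values on the vertex set matter; \<open>g\<close> is unconstrained elsewhere.
\<close>

definition resolving_function :: "'a pair_pre_digraph \<Rightarrow> ('a \<Rightarrow> real) \<Rightarrow> bool" where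
  "resolving_function G g \<longleftrightarrow>
    (\<forall>v \<in> pverts G. 0 \<le> g v \<and> g v \<le> 1) \<and>
    (\<forall>x \<in> pverts G. \<forall>y \<in> pverts G. x \<noteq> y \<longrightarrow> 1 \<le> sum g (resolving_set G x y))"

text \<open>
  The simultaneous fractional dimension of two graphs on the same vertex set. That the minimum
  exists for \<open>G\<close> and its complement is shown in \<open>Sd_f_complement_min\<close>.
\<close>

definition Sd_f :: "'a pair_pre_digraph \<Rightarrow> 'a pair_pre_digraph \<Rightarrow> real" where
  "Sd_f G H =
    (LEAST r. \<exists>g. resolving_function G g \<and> resolving_function H g \<and> r = sum g (pverts G))"

definition open_nbhd :: "'a pair_pre_digraph \<Rightarrow> 'a \<Rightarrow> 'a set" where
  "open_nbhd G v = {u \<in> pverts G. (v, u) \<in> parcs G}"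

definition twin_rel :: "'a pair_pre_digraph \<Rightarrow> 'a rel" where
  "twin_rel G = {(u, w). u \<in> pverts G \<and> w \<in> pverts G \<and>
    open_nbhd G u - {w} = open_nbhd G w - {u}}"

definition twin_classes :: "'a pair_pre_digraph \<Rightarrow> 'a set set" where
  "twin_classes G = pverts G // twin_rel G"


lemma pverts_complement_graph [simp]: "pverts (complement_graph G) = pverts G"
  by (simp add: complement_graph_def)

lemma pair_graph_complement_graph:
  assumes "pair_graph G"
  shows "pair_graph (complement_graph G)"
proof -
  interpret pair_graph G by fact
  have "finite (parcs (complement_graph G))"
    by (rule finite_subset[of _ "pverts G \<times> pverts G"])
      (auto simp: complement_graph_def pair_finite_verts)
  moreover have "sym (parcs G)"
    using pair_sym_arcs by (simp add: symmetric_def)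
  ultimately show ?thesis
    by unfold_locales
      (auto simp: complement_graph_def symmetric_def sym_def pair_finite_verts)
qed

lemma pair_graph_path_graph: "pair_graph (path_graph n)"
proof -
  have "finite (parcs (path_graph n))"
    by (rule finite_subset[of _ "{0..<n} \<times> {0..<n}"]) (auto simp: path_graph_def)
  then show ?thesis
    by unfold_locales (auto simp: path_graph_def symmetric_def sym_def)
qed

lemma equiv_twin_rel:
  assumes "pair_graph G"
  shows "equiv (pverts G) (twin_rel G)"
proof -
  interpret pair_graph G by fact
  have s: "(v, u) \<in> parcs G" if "(u, v) \<in> parcs G" for u v
    using pair_sym_arcs that by (auto simp: symmetric_def sym_def)
  have irr: "(u, u) \<notin> parcs G" for u
    using pair_no_loops by fastforce
  have tw: "(u, w) \<in> twin_rel G \<longleftrightarrow> u \<in> pverts G \<and> w \<in> pverts G \<and>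
      (\<forall>z. z \<noteq> u \<and> z \<noteq> w \<longrightarrow> ((u, z) \<in> parcs G \<longleftrightarrow> (w, z) \<in> parcs G))" for u w
    using irr wellformed' by (auto simp: twin_rel_def open_nbhd_def set_eq_iff; metis)
  have "trans (twin_rel G)"
  proof (rule transI)
    fix u v w assume uv: "(u, v) \<in> twin_rel G" and vw: "(v, w) \<in> twin_rel G"
    have "(u, z) \<in> parcs G \<longleftrightarrow> (w, z) \<in> parcs G" if "z \<noteq> u" "z \<noteq> w" for z
    proof (cases "z = v")
      case True
      show ?thesis
      proof (cases "u = w")
        case False
        have "(u, v) \<in> parcs G \<longleftrightarrow> (w, u) \<in> parcs G"
          using vw False True that s tw by metis
        also have "\<dots> \<longleftrightarrow> (v, w) \<in> parcs G"
          using uv False True that s tw by metis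
        finally show ?thesis using True s by blast
      qed simp
    qed (use uv vw tw that in metis)
    then show "(u, w) \<in> twin_rel G" using uv vw tw by simp
  qed
  then show ?thesis
    by (auto simp: equiv_def refl_on_def sym_def tw)
qed

lemma graph_dist_eq_0_iff:
  assumes "x \<in> pverts G"
  shows "graph_dist G x y = 0 \<longleftrightarrow> x = y"
proof -
  interpret pair_pre_digraph G .
  let ?S = "(\<lambda>p. enat (length p)) ` {p. pre_digraph.apath (with_proj G) x p y}"
  have "pre_digraph.apath (with_proj G) x [] y \<longleftrightarrow> x = y"
    using assms by (auto simp: pre_digraph.apath_def pre_digraph.awalk_def
        cas_with_proj_eq awalk_verts_with_proj_eq)
  then have "0 \<in> ?S \<longleftrightarrow> x = y"
    by (auto simp: image_iff zero_enat_def)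
  moreover have "Inf ?S = 0 \<longleftrightarrow> 0 \<in> ?S"
    by (metis (no_types, lifting) Inf_enat_def LeastI_ex Inf_lower ex_in_conv i0_ne_infinity le_zero_eq)
  ultimately show ?thesis by (simp add: graph_dist_def)
qed

lemma resolving_function_one:
  assumes "finite (pverts G)"
  shows "resolving_function G (\<lambda>_. 1)"
proof -
  have "1 \<le> card (resolving_set G x y)" if "x \<in> pverts G" "y \<in> pverts G" "x \<noteq> y" for x y
  proof -
    have "x \<in> resolving_set G x y"
      using that graph_dist_eq_0_iff[of x G x] graph_dist_eq_0_iff[of y G x]
      by (auto simp: resolving_set_def)
    moreover have "finite (resolving_set G x y)"
      using assms by (simp add: resolving_set_def)
    ultimately show ?thesis
      by (metis One_nat_def Suc_leI card_gt_0_iff empty_iff)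
  qed
  then show ?thesis by (auto simp: resolving_function_def)
qed

lemma Sd_f_complement_min:
  assumes "pair_graph G"
  shows "\<exists>g. resolving_function G g \<and> resolving_function (complement_graph G) g \<and>
      Sd_f G (complement_graph G) = sum g (pverts G)"
    and "resolving_function G g \<Longrightarrow> resolving_function (complement_graph G) g \<Longrightarrow>
      Sd_f G (complement_graph G) \<le> sum g (pverts G)"
proof -
  interpret pair_graph G by fact
  let ?V = "pverts G"
  let ?H = "complement_graph G"
  have fin: "finite ?V" by (rule pair_finite_verts)
  define R where "R g \<longleftrightarrow> resolving_function G g \<and> resolving_function ?H g" for g
  define B :: "('a \<Rightarrow> real) set" where "B = PiE UNIV (\<lambda>v. if v \<in> ?V then {0..1} else {0})"
  define C where "C K x y = {g :: 'a \<Rightarrow> real. 1 \<le> sum g (resolving_set K x y)}" for K x y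
  define D where "D = (\<Inter>x\<in>?V. \<Inter>y\<in>?V - {x}. C G x y \<inter> C ?H x y)"
  have contsum: "continuous_on UNIV (\<lambda>g :: 'a \<Rightarrow> real. sum g S)" for S
    by (intro continuous_intros continuous_on_product_coordinates)
  have "compact B"
  proof -
    have "compactin (product_topology (\<lambda>_. euclidean) UNIV) B"
      unfolding B_def compactin_PiE by auto
    then show ?thesis by (simp add: euclidean_product_topology)
  qed
  moreover have "closed D"
    unfolding D_def C_def
    by (intro closed_INT ballI closed_Int closed_Collect_le continuous_on_const contsum)
  ultimately have "compact (B \<inter> D)" by (rule compact_Int_closed)
  have inBD: "(\<lambda>v. if v \<in> ?V then g v else 0) \<in> B \<inter> D" if "R g" for g
  proof -
    have "sum (\<lambda>v. if v \<in> ?V then g v else 0) (resolving_set K x y) = sum g (resolving_set K x y)"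
      if "pverts K = ?V" for K x y
      using that by (intro sum.cong) (auto simp: resolving_set_def)
    then show ?thesis
      using that by (auto simp: R_def B_def C_def D_def resolving_function_def)
  qed
  have BDR: "R g" if "g \<in> B \<inter> D" for g
  proof -
    have "g v \<in> {0..1}" if "v \<in> ?V" for v
    proof -
      have "g v \<in> (if v \<in> ?V then {0..1} else {0})"
        using \<open>g \<in> B \<inter> D\<close> unfolding B_def by blast
      then show ?thesis using that by simp
    qed
    then show ?thesis
      using that by (auto simp: R_def C_def D_def resolving_function_def)
  qed
  have "R (\<lambda>_. 1)"
    using fin by (simp add: R_def resolving_function_one)
  then have "B \<inter> D \<noteq> {}" using inBD by blast
  then obtain g0 where g0: "g0 \<in> B \<inter> D" "\<And>g. g \<in> B \<inter> D \<Longrightarrow> sum g0 ?V \<le> sum g ?V"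
    using continuous_attains_inf[OF \<open>compact (B \<inter> D)\<close> _ continuous_on_subset[OF contsum]]
    by (metis (no_types, lifting) subset_UNIV)
  have min: "sum g0 ?V \<le> sum g ?V" if "R g" for g
  proof -
    have "sum g0 ?V \<le> sum (\<lambda>v. if v \<in> ?V then g v else 0) ?V"
      using g0(2) inBD[OF that] by blast
    then show ?thesis by simp
  qed
  have eq: "Sd_f G ?H = sum g0 ?V"
    unfolding Sd_f_def
    using BDR[OF g0(1)] min by (intro Least_equality) (auto simp: R_def)
  then show "\<exists>g. resolving_function G g \<and> resolving_function ?H g \<and> Sd_f G ?H = sum g ?V"
    using BDR[OF g0(1)] by (auto simp: R_def)
  show "Sd_f G ?H \<le> sum g ?V" if "resolving_function G g" "resolving_function ?H g"
    using that min eq by (simp add: R_def)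
qed

end

theory Submission
  imports Defs
begin

text \<open>
  A vertex \<open>z\<close> that is one of \<open>x, y\<close> or is adjacent to exactly one of them resolves \<open>x\<close> and \<open>y\<close>,
  because distances 0 and 1 can be read off from the arcs; and since taking complements preserves
  ``adjacent to exactly one of them'', such a \<open>z\<close> resolves \<open>x\<close> and \<open>y\<close> in the complement too. So a
  weighting that puts weight at least 1 on each of these sets (\<open>adj_resolving_set\<close>) is feasible for
  both graphs at once (\<open>Sd_f_le_adjI\<close>), and all upper bounds come from this. Lower bounds come from
  the few situations in which the full resolving sets are as small as that.

  \<^emph>\<open>Value 1.\<close> A resolving set with weight at least 1 exhausts a total weight of 1, so each vertex \<open>v\<close>
  of positive weight resolves every pair in both graphs. Two neighbours of \<open>v\<close> are at the same
  distance from it in the graph, two non-neighbours in the complement; hence \<open>v\<close> has at most one of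
  each, and there are at most three vertices. Conversely, if \<open>v\<close> has at most one neighbour and at
  most one non-neighbour, then the whole weight may be put on \<open>v\<close> (\<open>Sd_f_eq_1_iff\<close>). Listing the
  graphs with such a vertex gives the two- and three-vertex paths and their complements
  (\<open>adj_separates_rest_iff_iso\<close>).

  \<^emph>\<open>Value \<open>n/2\<close>.\<close> The constant weight 1/2 is always feasible. A walk leaving a vertex can be
  rerouted to leave from a twin of it, so twins \<open>x, y\<close> are resolved only by themselves and carry
  weight at least 1 together; averaging over a class of at least two twins gives weight at least 1/2
  per vertex (\<open>Sd_f_ge_half_card_if_twins\<close>). If \<open>v\<close> has no twin but itself, then every pair
  containing \<open>v\<close> is separated by a third vertex, so the weight of \<open>v\<close> can be lowered from 1/2 to 0
  (\<open>Sd_f_less_half_card_if_twinless\<close>).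
\<close>

section \<open>Distances zero and one\<close>

context pair_graph
begin

lemma arc_sym_iff: "(u, v) \<in> parcs G \<longleftrightarrow> (v, u) \<in> parcs G"
  using pair_sym_arcs by (auto simp: symmetric_def sym_def)

lemma not_self_arc [simp]: "(u, u) \<notin> parcs G"
  using pair_no_loops by fastforce

lemma graph_dist_attained:
  assumes "graph_dist G x y \<noteq> \<infinity>"
  obtains p where "apath x p y" "graph_dist G x y = enat (length p)"
proof -
  let ?S = "(\<lambda>p. enat (length p)) ` {p. apath x p y}"
  have "Inf ?S \<noteq> \<infinity>"
    using assms by (simp add: graph_dist_def)
  then have "?S \<noteq> {}"
    by (metis Inf_enat_def)
  then have "Inf ?S \<in> ?S"
    by (metis (no_types, lifting) Inf_enat_def LeastI_ex ex_in_conv)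
  then show ?thesis
    using that by (auto simp: graph_dist_def)
qed

lemma graph_dist_le_apath: "apath x p y \<Longrightarrow> graph_dist G x y \<le> enat (length p)"
  unfolding graph_dist_def by (rule INF_lower) simp

lemma graph_dist_eq_1_iff:
  assumes "x \<in> pverts G"
  shows "graph_dist G x y = 1 \<longleftrightarrow> (x, y) \<in> parcs G"
proof
  assume "graph_dist G x y = 1"
  then obtain p where p: "apath x p y" "enat (length p) = 1"
    by (metis graph_dist_attained infinity_ne_i1)
  then have "length p = Suc 0"
    by (simp add: one_enat_def)
  then obtain e where "p = [e]"
    by (auto simp: length_Suc_conv)
  then show "(x, y) \<in> parcs G"
    using p(1) by (cases e) (auto simp: apath_simps)
next
  assume xy: "(x, y) \<in> parcs G"
  then have "x \<noteq> y"
    by auto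
  then have "graph_dist G x y \<noteq> 0"
    using assms by (simp add: graph_dist_eq_0_iff)
  moreover have "apath x [(x, y)] y"
    using xy \<open>x \<noteq> y\<close> wellformed' by (auto simp: apath_simps)
  then have "graph_dist G x y \<le> 1"
    using graph_dist_le_apath by (fastforce simp: one_enat_def)
  ultimately show "graph_dist G x y = 1"
    by (metis iless_eSuc0 one_eSuc order_le_less)
qed

text \<open>
  Distances are infima over paths. Bounding them by walks instead makes it unnecessary to keep
  vertices distinct when a path is rerouted.
\<close>

lemma awalk_imp_short_apath: "awalk u p v \<Longrightarrow> \<exists>q. apath u q v \<and> length q \<le> length p"
proof (induction p arbitrary: u)
  case Nil
  then show ?case by (auto simp: awalk_simps apath_simps)
next
  case (Cons e p)
  then have e: "e \<in> parcs G" "u = fst e" "awalk (snd e) p v"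
    by (auto simp: awalk_Cons_iff)
  then obtain q where q: "apath (snd e) q v" "length q \<le> length p"
    using Cons.IH by blast
  show ?case
  proof (cases "u \<in> set (awalk_verts (snd e) q)")
    case False
    then have "apath u (e # q) v"
      using e q by (auto simp: apath_Cons_iff)
    then show ?thesis using q(2) by (intro exI[of _ "e # q"]) simp
  next
    case True
    then obtain r s where "q = r @ s" "awalk (snd e) r u" "awalk u s v"
      using q(1) awalk_decomp by (metis awalkI_apath)
    then have "apath u s v"
      using q(1) apath_append_iff by (metis awalkE' awalkE)
    then show ?thesis using q(2) \<open>q = r @ s\<close> by (intro exI[of _ s]) simp
  qed
qed

lemma graph_dist_le_awalk: "awalk u p v \<Longrightarrow> graph_dist G u v \<le> enat (length p)"
  by (meson awalk_imp_short_apath graph_dist_le_apath enat_ord_simps(1) order_trans)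

end

section \<open>Vertices separated by adjacency\<close>

text \<open>
  The vertices that tell \<open>x\<close> and \<open>y\<close> apart by looking no further than their neighbours. Passing to
  the complement does not change this set, and that makes one condition serve both graphs.
\<close>

definition adj_resolving_set :: "'a pair_pre_digraph \<Rightarrow> 'a \<Rightarrow> 'a \<Rightarrow> 'a set" where
  "adj_resolving_set G x y =
    {z \<in> pverts G. z = x \<or> z = y \<or> ((x, z) \<in> parcs G) \<noteq> ((y, z) \<in> parcs G)}"

lemma adj_resolving_set_complement:
  "x \<in> pverts G \<Longrightarrow> y \<in> pverts G \<Longrightarrow>
    adj_resolving_set (complement_graph G) x y = adj_resolving_set G x y"
  by (auto simp: adj_resolving_set_def complement_graph_def)

context pair_graph
begin

lemma adj_resolving_subset_resolving:
  assumes "x \<in> pverts G" "y \<in> pverts G" "x \<noteq> y"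
  shows "adj_resolving_set G x y \<subseteq> resolving_set G x y"
proof
  fix z assume "z \<in> adj_resolving_set G x y"
  then consider "z = x" | "z = y" | "z \<in> pverts G" "((x, z) \<in> parcs G) \<noteq> ((y, z) \<in> parcs G)"
    unfolding adj_resolving_set_def by blast
  then show "z \<in> resolving_set G x y"
  proof cases
    case 1
    then show ?thesis
      using assms graph_dist_eq_0_iff[of x G x] graph_dist_eq_0_iff[of y G x]
      by (auto simp: resolving_set_def)
  next
    case 2
    then show ?thesis
      using assms graph_dist_eq_0_iff[of y G y] graph_dist_eq_0_iff[of x G y]
      by (auto simp: resolving_set_def)
  next
    case 3
    then have "graph_dist G x z \<noteq> graph_dist G y z"
      using assms graph_dist_eq_1_iff by metis
    then show ?thesis
      using \<open>z \<in> pverts G\<close> by (simp add: resolving_set_def)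
  qed
qed

lemma resolving_function_adjI:
  assumes "\<And>v. v \<in> pverts G \<Longrightarrow> 0 \<le> g v \<and> g v \<le> 1"
    and "\<And>x y. x \<in> pverts G \<Longrightarrow> y \<in> pverts G \<Longrightarrow> x \<noteq> y \<Longrightarrow> 1 \<le> sum g (adj_resolving_set G x y)"
  shows "resolving_function G g"
  unfolding resolving_function_def
proof (intro conjI ballI impI)
  fix x y assume xy: "x \<in> pverts G" "y \<in> pverts G" "x \<noteq> y"
  have "sum g (adj_resolving_set G x y) \<le> sum g (resolving_set G x y)"
    using adj_resolving_subset_resolving[OF xy] assms(1) pair_finite_verts
    by (intro sum_mono2) (auto simp: resolving_set_def)
  then show "1 \<le> sum g (resolving_set G x y)"
    using assms(2)[OF xy] by simp
qed (use assms(1) in auto)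

lemma Sd_f_le_adjI:
  assumes "\<And>v. v \<in> pverts G \<Longrightarrow> 0 \<le> g v \<and> g v \<le> 1"
    and "\<And>x y. x \<in> pverts G \<Longrightarrow> y \<in> pverts G \<Longrightarrow> x \<noteq> y \<Longrightarrow> 1 \<le> sum g (adj_resolving_set G x y)"
  shows "Sd_f G (complement_graph G) \<le> sum g (pverts G)"
proof -
  interpret H: pair_graph "complement_graph G"
    by (rule pair_graph_complement_graph) unfold_locales
  have "pair_graph G" by unfold_locales
  moreover have "resolving_function G g"
    using assms by (rule resolving_function_adjI)
  moreover have "resolving_function (complement_graph G) g"
    using assms by (intro H.resolving_function_adjI) (auto simp: adj_resolving_set_complement)
  ultimately show ?thesis
    by (rule Sd_f_complement_min(2))
qed

lemma Sd_f_attained: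
  obtains g where "resolving_function G g" "resolving_function (complement_graph G) g"
    "Sd_f G (complement_graph G) = sum g (pverts G)"
proof -
  have "pair_graph G" by unfold_locales
  then show ?thesis
    using Sd_f_complement_min(1) that by blast
qed

section \<open>Simultaneous dimension one\<close>

lemma Sd_f_ge_1:
  assumes "2 \<le> card (pverts G)"
  shows "1 \<le> Sd_f G (complement_graph G)"
proof -
  obtain g where g: "resolving_function G g" "Sd_f G (complement_graph G) = sum g (pverts G)"
    using Sd_f_attained by blast
  obtain x y where xy: "x \<in> pverts G" "y \<in> pverts G" "x \<noteq> y"
    using assms by (metis card_le_Suc0_iff_eq pair_finite_verts not_less_eq_eq numeral_2_eq_2)
  have "1 \<le> sum g (resolving_set G x y)"
    using g(1) xy by (auto simp: resolving_function_def)
  also have "\<dots> \<le> sum g (pverts G)"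
    using g(1) by (intro sum_mono2) (auto simp: resolving_set_def resolving_function_def pair_finite_verts)
  finally show ?thesis using g(2) by simp
qed

end

text \<open>
  Removing \<open>v\<close> from a total weight of 1 leaves less than what each resolving set must carry.
\<close>

lemma resolving_function_weight_1_support:
  assumes "finite (pverts G)" "resolving_function G g" "sum g (pverts G) = 1"
    and "v \<in> pverts G" "g v > 0" "x \<in> pverts G" "y \<in> pverts G" "x \<noteq> y"
  shows "v \<in> resolving_set G x y"
proof (rule ccontr)
  assume "v \<notin> resolving_set G x y"
  then have "sum g (resolving_set G x y) \<le> sum g (pverts G - {v})"
    using assms(1,2) by (intro sum_mono2) (auto simp: resolving_set_def resolving_function_def)
  also have "\<dots> < 1"
    using assms by (simp add: sum_diff1)
  finally show False
    using assms by (force simp: resolving_function_def)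
qed

text \<open>
  Equivalently, \<open>v\<close> has at most one neighbour and, besides itself, at most one non-neighbour. The
  pairwise form is visibly invariant under complements and isomorphisms.
\<close>

definition adj_separates_rest :: "'a pair_pre_digraph \<Rightarrow> 'a \<Rightarrow> bool" where
  "adj_separates_rest G v \<longleftrightarrow>
    (\<forall>x \<in> pverts G - {v}. \<forall>y \<in> pverts G - {v}. x \<noteq> y \<longrightarrow>
      ((v, x) \<in> parcs G) \<noteq> ((v, y) \<in> parcs G))"

context pair_graph
begin

lemma Sd_f_eq_1_iff:
  assumes "2 \<le> card (pverts G)"
  shows "Sd_f G (complement_graph G) = 1 \<longleftrightarrow> (\<exists>v \<in> pverts G. adj_separates_rest G v)"
proof
  let ?H = "complement_graph G"
  interpret H: pair_graph ?H
    by (rule pair_graph_complement_graph) unfold_locales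
  assume one: "Sd_f G ?H = 1"
  obtain g where g: "resolving_function G g" "resolving_function ?H g" "sum g (pverts G) = 1"
    using Sd_f_attained one by metis
  obtain v where v: "v \<in> pverts G" "g v > 0"
    using g(3) sum_nonpos[of "pverts G" g] by (metis not_le not_one_le_zero)
  have "adj_separates_rest G v"
    unfolding adj_separates_rest_def
  proof (intro ballI impI)
    fix x y assume xy: "x \<in> pverts G - {v}" "y \<in> pverts G - {v}" "x \<noteq> y"
    have "v \<in> resolving_set G x y" "v \<in> resolving_set ?H x y"
      using resolving_function_weight_1_support g v xy pair_finite_verts
      by (metis DiffD1 pverts_complement_graph)+
    then have "graph_dist G x v \<noteq> graph_dist G y v" "graph_dist ?H x v \<noteq> graph_dist ?H y v"
      by (auto simp: resolving_set_def)
    \<comment> \<open>Two neighbours of \<open>v\<close> have the same distance in the graph, two non-neighbours in the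
      complement.\<close>
    then have "\<not> ((x, v) \<in> parcs G \<and> (y, v) \<in> parcs G)"
      "\<not> ((x, v) \<in> parcs ?H \<and> (y, v) \<in> parcs ?H)"
      using xy graph_dist_eq_1_iff H.graph_dist_eq_1_iff by (metis DiffD1 pverts_complement_graph)+
    then show "((v, x) \<in> parcs G) \<noteq> ((v, y) \<in> parcs G)"
      using xy v arc_sym_iff by (auto simp: complement_graph_def)
  qed
  then show "\<exists>v \<in> pverts G. adj_separates_rest G v"
    using v by blast
next
  assume "\<exists>v \<in> pverts G. adj_separates_rest G v"
  then obtain v where v: "v \<in> pverts G" "adj_separates_rest G v"
    by blast
  \<comment> \<open>All the weight sits on \<open>v\<close>, which lies in every adjacency resolving set.\<close>
  let ?g = "\<lambda>z. if z = v then 1 else 0 :: real"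
  have "v \<in> adj_resolving_set G x y" if "x \<in> pverts G" "y \<in> pverts G" "x \<noteq> y" for x y
    using v that arc_sym_iff by (auto simp: adj_resolving_set_def adj_separates_rest_def)
  then have "Sd_f G (complement_graph G) \<le> sum ?g (pverts G)"
    using pair_finite_verts by (intro Sd_f_le_adjI) (auto simp: adj_resolving_set_def)
  then show "Sd_f G (complement_graph G) = 1"
    using v(1) pair_finite_verts Sd_f_ge_1[OF assms] by simp
qed

end

text \<open>
  For graphs given by pairs the arc component of an isomorphism is forced by its vertex component,
  so only the usual vertex bijection preserving and reflecting arcs remains.
\<close>

lemma digraph_iso_with_proj_iff:
  assumes "pair_wf_digraph G" "pair_wf_digraph H"
  shows "digraph_iso (with_proj G) (with_proj H) \<longleftrightarrow>
    (\<exists>f. bij_betw f (pverts G) (pverts H) \<and>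
      (\<forall>x \<in> pverts G. \<forall>y \<in> pverts G. (x, y) \<in> parcs G \<longleftrightarrow> (f x, f y) \<in> parcs H))"
proof
  interpret G: pair_wf_digraph G by fact
  assume "digraph_iso (with_proj G) (with_proj H)"
  then obtain hom where hom: "G.digraph_isomorphism hom" "with_proj H = app_iso hom (with_proj G)"
    by (auto simp: digraph_iso_def)
  define f where "f = iso_verts hom"
  have V: "pverts H = f ` pverts G" and E: "parcs H = iso_arcs hom ` parcs G"
    and ends: "fst = iso_tail hom" "snd = iso_head hom"
    using arg_cong[OF hom(2), of verts] arg_cong[OF hom(2), of arcs]
      arg_cong[OF hom(2), of tail] arg_cong[OF hom(2), of head]
    by (simp_all add: f_def)
  have inj: "inj_on f (pverts G)"
    using hom(1) by (simp add: G.digraph_isomorphism_def f_def)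
  have arc: "iso_arcs hom (a, b) = (f a, f b)" if "(a, b) \<in> parcs G" for a b
  proof -
    have "f a = iso_tail hom (iso_arcs hom (a, b))" "f b = iso_head hom (iso_arcs hom (a, b))"
      using hom(1) that by (auto simp: G.digraph_isomorphism_def f_def)
    then show ?thesis
      by (simp add: ends[symmetric])
  qed
  have "(x, y) \<in> parcs G \<longleftrightarrow> (f x, f y) \<in> parcs H" if xy: "x \<in> pverts G" "y \<in> pverts G" for x y
  proof
    assume "(f x, f y) \<in> parcs H"
    then obtain a b where ab: "(a, b) \<in> parcs G" "(f x, f y) = iso_arcs hom (a, b)"
      by (auto simp: E)
    then have "f x = f a" "f y = f b"
      using arc by auto
    then show "(x, y) \<in> parcs G"
      using inj xy ab(1) G.wellformed' by (metis inj_onD)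
  qed (use arc E in force)
  then show "\<exists>f. bij_betw f (pverts G) (pverts H) \<and>
      (\<forall>x \<in> pverts G. \<forall>y \<in> pverts G. (x, y) \<in> parcs G \<longleftrightarrow> (f x, f y) \<in> parcs H)"
    using inj V by (auto simp: bij_betw_def)
next
  interpret G: pair_wf_digraph G by fact
  interpret H: pair_wf_digraph H by fact
  assume "\<exists>f. bij_betw f (pverts G) (pverts H) \<and>
      (\<forall>x \<in> pverts G. \<forall>y \<in> pverts G. (x, y) \<in> parcs G \<longleftrightarrow> (f x, f y) \<in> parcs H)"
  then obtain f where f: "bij_betw f (pverts G) (pverts H)"
    and arc: "\<And>x y. x \<in> pverts G \<Longrightarrow> y \<in> pverts G \<Longrightarrow> (x, y) \<in> parcs G \<longleftrightarrow> (f x, f y) \<in> parcs H"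
    by blast
  have inj: "inj_on f (pverts G)" and V: "pverts H = f ` pverts G"
    using f by (auto simp: bij_betw_def)
  let ?hom = "\<lparr> iso_verts = f, iso_arcs = map_prod f f, iso_head = snd, iso_tail = fst \<rparr>"
  have "inj_on (map_prod f f) (parcs G)"
    using map_prod_inj_on[OF inj inj] by (rule inj_on_subset) (auto dest: G.wellformed')
  then have "G.digraph_isomorphism ?hom"
    using inj by (simp add: G.digraph_isomorphism_def G.wf_digraph_axioms)
  moreover have "map_prod f f ` parcs G = parcs H"
  proof (rule set_eqI, rule iffI)
    fix e assume "e \<in> parcs H"
    then obtain x y where "e = (f x, f y)" "x \<in> pverts G" "y \<in> pverts G"
      using H.wellformed' V by (cases e) blast
    then show "e \<in> map_prod f f ` parcs G"
      using arc \<open>e \<in> parcs H\<close> by force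
  next
    fix e assume "e \<in> map_prod f f ` parcs G"
    then obtain x y where "e = (f x, f y)" "(x, y) \<in> parcs G"
      by force
    then show "e \<in> parcs H"
      using arc[of x y] G.wellformed' by blast
  qed
  then have "with_proj H = app_iso ?hom (with_proj G)"
    using V by (intro pre_digraph.equality) auto
  ultimately show "digraph_iso (with_proj G) (with_proj H)"
    by (auto simp: digraph_iso_def)
qed

lemma adj_separates_rest_complement:
  "v \<in> pverts G \<Longrightarrow> adj_separates_rest (complement_graph G) v \<longleftrightarrow> adj_separates_rest G v"
  by (auto simp: adj_separates_rest_def complement_graph_def)

lemma adj_separates_rest_iso:
  assumes "pair_wf_digraph G" "pair_wf_digraph H" "digraph_iso (with_proj G) (with_proj H)"
    and "w \<in> pverts H" "adj_separates_rest H w"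
  shows "\<exists>v \<in> pverts G. adj_separates_rest G v"
proof -
  obtain f where inj: "inj_on f (pverts G)" and V: "pverts H = f ` pverts G"
    and arc: "\<And>x y. x \<in> pverts G \<Longrightarrow> y \<in> pverts G \<Longrightarrow> (x, y) \<in> parcs G \<longleftrightarrow> (f x, f y) \<in> parcs H"
    using assms digraph_iso_with_proj_iff by (metis bij_betw_def)
  obtain v where v: "v \<in> pverts G" "w = f v"
    using V assms(4) by blast
  have "adj_separates_rest G v"
    unfolding adj_separates_rest_def
  proof (intro ballI impI)
    fix x y assume xy: "x \<in> pverts G - {v}" "y \<in> pverts G - {v}" "x \<noteq> y"
    then have "f x \<in> pverts H - {w}" "f y \<in> pverts H - {w}" "f x \<noteq> f y"
      using inj v(1) by (simp_all add: V v(2) inj_on_eq_iff)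
    then show "((v, x) \<in> parcs G) \<noteq> ((v, y) \<in> parcs G)"
      using assms(5) arc[of v x] arc[of v y] xy v unfolding adj_separates_rest_def by blast
  qed
  then show ?thesis using v by blast
qed

text \<open>
  An end vertex of a path with at most three vertices has at most one neighbour and at most one
  non-neighbour.
\<close>

lemma adj_separates_rest_path_graph: "n \<le> 3 \<Longrightarrow> adj_separates_rest (path_graph n) 0"
  by (auto simp: adj_separates_rest_def path_graph_def)

text \<open>
  With at most one neighbour \<open>a\<close> and one non-neighbour \<open>b\<close> of \<open>v\<close>, the graph is determined up to
  isomorphism by which of the two exist and, if both do, by whether they are adjacent. If they are,
  \<open>v, a, b\<close> is a path in the graph; if they are not, \<open>v, b, a\<close> is a path in the complement.
\<close>

lemma (in pair_graph) adj_separates_rest_iff_iso: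
  assumes "2 \<le> card (pverts G)"
  shows "(\<exists>v \<in> pverts G. adj_separates_rest G v) \<longleftrightarrow>
    digraph_iso (with_proj G) (with_proj (path_graph 2)) \<or>
    digraph_iso (with_proj G) (with_proj (complement_graph (path_graph 2))) \<or>
    digraph_iso (with_proj G) (with_proj (path_graph 3)) \<or>
    digraph_iso (with_proj G) (with_proj (complement_graph (path_graph 3)))"
    (is "?sep \<longleftrightarrow> ?iso")
proof
  have wf: "pair_wf_digraph G" "pair_wf_digraph (path_graph n)"
    "pair_wf_digraph (complement_graph (path_graph n))" for n
    using pair_graph_path_graph[of n] pair_graph_complement_graph[of "path_graph n"]
    by (auto simp: pair_graph_def pair_digraph_def pair_fin_digraph_def intro: pair_wf_digraph_axioms)
  have path0: "0 \<in> pverts (path_graph n)" if "n \<ge> 2" for n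
    using that by (simp add: path_graph_def)
  show ?sep if ?iso
  proof -
    have path: "adj_separates_rest (path_graph n) 0"
      "adj_separates_rest (complement_graph (path_graph n)) 0" if "n \<in> {2, 3}" for n
      using that path0[of n] adj_separates_rest_path_graph[of n]
      by (auto simp: adj_separates_rest_complement)
    show ?thesis
      using that path[of 2] path[of 3] path0[of 2] path0[of 3]
        adj_separates_rest_iso[OF wf(1,2), of _ 0] adj_separates_rest_iso[OF wf(1,3), of _ 0]
      by auto
  qed
  assume ?sep
  then obtain v where v: "v \<in> pverts G" "adj_separates_rest G v"
    by blast
  define A where "A = {x \<in> pverts G - {v}. (v, x) \<in> parcs G}"
  define B where "B = {x \<in> pverts G - {v}. (v, x) \<notin> parcs G}"
  have V: "pverts G = insert v (A \<union> B)" and vAB: "v \<notin> A" "v \<notin> B" and AB: "A \<inter> B = {}"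
    using v(1) by (auto simp: A_def B_def)
  have memA: "(v, a) \<in> parcs G" if "a \<in> A" for a
    using that by (simp add: A_def)
  have memB: "(v, b) \<notin> parcs G" if "b \<in> B" for b
    using that by (simp add: B_def)
  have "x = y" if "x \<in> A" "y \<in> A" for x y
    using v(2) that by (auto simp: A_def adj_separates_rest_def)
  then have Acases: "A = {} \<or> (\<exists>a. A = {a})" by blast
  have "x = y" if "x \<in> B" "y \<in> B" for x y
    using v(2) that by (auto simp: B_def adj_separates_rest_def)
  then have Bcases: "B = {} \<or> (\<exists>b. B = {b})" by blast
  have iso: "digraph_iso (with_proj G) (with_proj H)" if "pair_wf_digraph H"
    "bij_betw f (pverts G) (pverts H)"
    "\<forall>x \<in> pverts G. \<forall>y \<in> pverts G. (x, y) \<in> parcs G \<longleftrightarrow> (f x, f y) \<in> parcs H"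
    for f and H :: "nat pair_pre_digraph"
    using that digraph_iso_with_proj_iff[OF wf(1)] by blast
  have "A \<noteq> {} \<or> B \<noteq> {}"
    using assms V by auto
  then consider a where "A = {a}" "B = {}" | b where "A = {}" "B = {b}"
    | a b where "A = {a}" "B = {b}"
    using Acases Bcases by blast
  then show ?iso
  proof cases
    case (1 a)
    then have "a \<noteq> v" "pverts G = {v, a}" "(v, a) \<in> parcs G" "(a, v) \<in> parcs G"
      using V vAB(1) memA[of a] arc_sym_iff[of a v] by auto
    then have "digraph_iso (with_proj G) (with_proj (path_graph 2))"
      by (intro iso[of _ "\<lambda>x. if x = v then 0 else 1"] wf)
        (auto simp: path_graph_def bij_betw_def)
    then show ?thesis by blast
  next
    case (2 b)
    then have "b \<noteq> v" "pverts G = {v, b}" "(v, b) \<notin> parcs G" "(b, v) \<notin> parcs G"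
      using V vAB(2) memB[of b] arc_sym_iff[of b v] by auto
    then have "digraph_iso (with_proj G) (with_proj (complement_graph (path_graph 2)))"
      by (intro iso[of _ "\<lambda>x. if x = v then 0 else 1"] wf)
        (auto simp: path_graph_def complement_graph_def bij_betw_def)
    then show ?thesis by blast
  next
    case (3 a b)
    then have *: "a \<noteq> v" "b \<noteq> v" "a \<noteq> b" "pverts G = {v, a, b}" "(v, a) \<in> parcs G" "(a, v) \<in> parcs G"
      "(v, b) \<notin> parcs G" "(b, v) \<notin> parcs G"
      using V vAB AB memA[of a] memB[of b] arc_sym_iff[of a v] arc_sym_iff[of b v] by auto
    show ?thesis
    proof (cases "(a, b) \<in> parcs G")
      case True
      then have "(b, a) \<in> parcs G" using arc_sym_iff by blast
      then have "digraph_iso (with_proj G) (with_proj (path_graph 3))"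
        using * True
        by (intro iso[of _ "\<lambda>x. if x = v then 0 else if x = a then 1 else 2"] wf)
          (auto simp: path_graph_def bij_betw_def)
      then show ?thesis by blast
    next
      case False
      then have "(b, a) \<notin> parcs G" using arc_sym_iff by blast
      then have "digraph_iso (with_proj G) (with_proj (complement_graph (path_graph 3)))"
        using * False
        by (intro iso[of _ "\<lambda>x. if x = v then 0 else if x = b then 1 else 2"] wf)
          (auto simp: path_graph_def complement_graph_def bij_betw_def)
      then show ?thesis by blast
    qed
  qed
qed

section \<open>Twins and the value n/2\<close>

context pair_graph
begin

lemma twin_rel_iff_adj_resolving_set:
  assumes "x \<in> pverts G" "y \<in> pverts G" "x \<noteq> y"
  shows "(x, y) \<in> twin_rel G \<longleftrightarrow> adj_resolving_set G x y = {x, y}"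
  using assms wellformed'
  by (auto simp: twin_rel_def open_nbhd_def adj_resolving_set_def set_eq_iff; metis not_self_arc)

text \<open>
  A shortest path from \<open>x\<close> to \<open>z\<close> either passes to the twin \<open>y\<close> in its first step, and then its rest
  starts at \<open>y\<close>, or passes to a common neighbour, and then its first arc may start at \<open>y\<close> instead.
\<close>

lemma graph_dist_twin_le:
  assumes "(x, y) \<in> twin_rel G" "z \<noteq> x"
  shows "graph_dist G y z \<le> graph_dist G x z"
proof (cases "graph_dist G x z = \<infinity>")
  case False
  then obtain p where p: "apath x p z" "graph_dist G x z = enat (length p)"
    by (rule graph_dist_attained)
  then obtain e q where eq: "p = e # q"
    using assms(2) by (cases p) (auto simp: apath_simps)
  define w where "w = snd e"
  have xw: "(x, w) \<in> parcs G" and q: "awalk w q z"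
    using p(1) eq by (cases e; auto simp: apath_Cons_iff w_def awalkI_apath)+
  show ?thesis
  proof (cases "w = y")
    case True
    then have "graph_dist G y z \<le> enat (length q)"
      using q graph_dist_le_awalk by blast
    also have "\<dots> \<le> graph_dist G x z"
      using p(2) eq by simp
    finally show ?thesis .
  next
    case wy: False
    have "w \<in> open_nbhd G x - {y}"
      using xw wy wellformed' by (auto simp: open_nbhd_def)
    then have "(y, w) \<in> parcs G"
      using assms(1) by (auto simp: twin_rel_def open_nbhd_def)
    then have "awalk y ((y, w) # q) z"
      using q by (simp add: awalk_Cons_iff)
    then show ?thesis
      using graph_dist_le_awalk[of y "(y, w) # q" z] p(2) eq by simp
  qed
qed simp

lemma twins_resolving_set:
  assumes "(x, y) \<in> twin_rel G"
  shows "resolving_set G x y \<subseteq> {x, y}"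
proof -
  have "(y, x) \<in> twin_rel G"
    using assms by (auto simp: twin_rel_def)
  then have "graph_dist G x z = graph_dist G y z" if "z \<noteq> x" "z \<noteq> y" for z
    using graph_dist_twin_le assms that by (meson antisym)
  then show ?thesis by (auto simp: resolving_set_def)
qed

end

text \<open>
  At most one element can have weight below 1/2; paired with any other element it contributes 1.
\<close>

lemma sum_ge_half_card:
  fixes g :: "'a \<Rightarrow> real"
  assumes "finite C" "2 \<le> card C"
    and pair: "\<And>x y. x \<in> C \<Longrightarrow> y \<in> C \<Longrightarrow> x \<noteq> y \<Longrightarrow> 1 \<le> g x + g y"
  shows "real (card C) / 2 \<le> sum g C"
proof (cases "\<forall>x \<in> C. 1/2 \<le> g x")
  case True
  then have "sum (\<lambda>_. 1/2) C \<le> sum g C"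
    by (intro sum_mono) auto
  then show ?thesis by simp
next
  case False
  then obtain x where x: "x \<in> C" "g x < 1/2"
    by (auto simp: not_le)
  obtain y where y: "y \<in> C" "y \<noteq> x"
    using assms(1,2) by (metis card_le_Suc0_iff_eq not_less_eq_eq numeral_2_eq_2)
  have "1/2 \<le> g z" if "z \<in> C - {x, y}" for z
    using pair[of x z] x that by fastforce
  then have "sum (\<lambda>_. 1/2) (C - {x, y}) \<le> sum g (C - {x, y})"
    by (intro sum_mono) auto
  moreover have "card (C - {x, y}) = card C - 2"
    using x y assms(1) by (simp add: card_Diff_subset)
  moreover have "sum g C = sum g (C - {x, y}) + (g x + g y)"
    using x y assms(1) sum.subset_diff[of "{x, y}" C g] by simp
  ultimately show ?thesis
    using pair[of x y] x y assms(2) by simp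
qed

context pair_graph
begin

lemma Sd_f_ge_half_card_if_twins:
  assumes "\<forall>v \<in> pverts G. \<exists>C \<in> twin_classes G. v \<in> C \<and> 2 \<le> card C"
  shows "real (card (pverts G)) / 2 \<le> Sd_f G (complement_graph G)"
proof -
  obtain g where g: "resolving_function G g" "Sd_f G (complement_graph G) = sum g (pverts G)"
    using Sd_f_attained by blast
  have equiv: "equiv (pverts G) (twin_rel G)"
    by (rule equiv_twin_rel) unfold_locales
  have V: "pverts G = \<Union> (twin_classes G)"
    using Union_quotient[OF equiv] by (simp add: twin_classes_def)
  have fin: "finite C" if "C \<in> twin_classes G" for C
    using that pair_finite_verts V by (metis Union_upper finite_subset)
  have disj: "C \<inter> D = {}" if "C \<in> twin_classes G" "D \<in> twin_classes G" "C \<noteq> D" for C D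
    using that quotient_disj[OF equiv] by (auto simp: twin_classes_def)
  have half: "(\<Sum>_ \<in> C. 1/2) \<le> sum g C" if C: "C \<in> twin_classes G" for C
  proof -
    have "C \<noteq> {}"
      using C equiv by (auto simp: twin_classes_def dest: in_quotient_imp_non_empty)
    then obtain v D where "v \<in> C" "v \<in> D" "D \<in> twin_classes G" "2 \<le> card D"
      using assms C V by blast
    then have "2 \<le> card C"
      using disj C by blast
    moreover have "1 \<le> g x + g y" if xy: "x \<in> C" "y \<in> C" "x \<noteq> y" for x y
    proof -
      have tw: "(x, y) \<in> twin_rel G"
        using xy C quotient_eq_iff[OF equiv, of C C x y] by (simp add: twin_classes_def)
      have xyV: "x \<in> pverts G" "y \<in> pverts G"
        using xy C V by auto
      have "1 \<le> sum g (resolving_set G x y)"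
        using g(1) xyV xy(3) by (auto simp: resolving_function_def)
      also have "\<dots> \<le> sum g {x, y}"
        using twins_resolving_set[OF tw] g(1) xyV
        by (intro sum_mono2) (auto simp: resolving_function_def)
      finally show ?thesis using xy(3) by simp
    qed
    ultimately show ?thesis
      using sum_ge_half_card[of C g] fin[OF C] by simp
  qed
  have "real (card (pverts G)) / 2 = (\<Sum>_ \<in> pverts G. 1/2)"
    by simp
  also have "\<dots> = (\<Sum>C \<in> twin_classes G. \<Sum>_ \<in> C. 1/2)"
    using fin disj unfolding V by (subst sum.Union_disjoint) auto
  also have "\<dots> \<le> (\<Sum>C \<in> twin_classes G. sum g C)"
    by (rule sum_mono) (rule half)
  also have "\<dots> = sum g (pverts G)"
    using fin disj unfolding V by (subst sum.Union_disjoint) auto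
  finally show ?thesis using g(2) by simp
qed

lemma pair_subset_adj_resolving_set:
  "x \<in> pverts G \<Longrightarrow> y \<in> pverts G \<Longrightarrow> {x, y} \<subseteq> adj_resolving_set G x y"
  by (auto simp: adj_resolving_set_def)

lemma finite_adj_resolving_set: "finite (adj_resolving_set G x y)"
  using pair_finite_verts by (simp add: adj_resolving_set_def)

lemma Sd_f_le_half_card: "Sd_f G (complement_graph G) \<le> real (card (pverts G)) / 2"
proof -
  have "1 \<le> (\<Sum>_ \<in> adj_resolving_set G x y. 1/2 :: real)"
    if "x \<in> pverts G" "y \<in> pverts G" "x \<noteq> y" for x y
    using card_mono[OF finite_adj_resolving_set pair_subset_adj_resolving_set[OF that(1,2)]] that(3)
    by simp
  then have "Sd_f G (complement_graph G) \<le> (\<Sum>_ \<in> pverts G. 1/2)"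
    by (intro Sd_f_le_adjI) auto
  then show ?thesis by simp
qed

text \<open>
  The weight 0 on \<open>v\<close> and 1/2 elsewhere is feasible as soon as every adjacency resolving set has two
  elements besides \<open>v\<close>. This is clear for pairs avoiding \<open>v\<close>; for \<open>v\<close> and \<open>y\<close> these are \<open>y\<close> and
  a witness that \<open>v\<close> and \<open>y\<close> are not twins.
\<close>

lemma Sd_f_less_half_card_if_twinless:
  assumes v: "v \<in> pverts G" and twinless: "\<And>y. (v, y) \<in> twin_rel G \<Longrightarrow> y = v"
  shows "Sd_f G (complement_graph G) < real (card (pverts G)) / 2"
proof -
  let ?g = "\<lambda>z. if z = v then 0 else 1/2 :: real"
  have g: "sum ?g S = real (card (S - {v})) / 2" if "finite S" for S
  proof -
    have "sum ?g S = sum ?g (S - {v})"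
      using that by (intro sum.mono_neutral_right) auto
    also have "\<dots> = (\<Sum>_ \<in> S - {v}. 1/2)"
      by (rule sum.cong) auto
    finally show ?thesis by simp
  qed
  have two: "2 \<le> card (adj_resolving_set G x y - {v})"
    if xy: "x \<in> pverts G" "y \<in> pverts G" "x \<noteq> y" for x y
  proof -
    have "\<exists>a b. a \<noteq> b \<and> {a, b} \<subseteq> adj_resolving_set G x y - {v}"
    proof (cases "v \<in> {x, y}")
      case False
      then show ?thesis using pair_subset_adj_resolving_set[OF xy(1,2)] xy(3) by blast
    next
      case True
      then have "(x, y) \<notin> twin_rel G"
        using twinless xy(3) by (auto simp: twin_rel_def)
      then have "adj_resolving_set G x y \<noteq> {x, y}"
        using twin_rel_iff_adj_resolving_set[OF xy] by simp
      then obtain z where "z \<in> adj_resolving_set G x y" "z \<noteq> x" "z \<noteq> y"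
        using pair_subset_adj_resolving_set[OF xy(1,2)] by blast
      then show ?thesis
        using True pair_subset_adj_resolving_set[OF xy(1,2)] xy(3) by blast
    qed
    then obtain a b where "a \<noteq> b" "{a, b} \<subseteq> adj_resolving_set G x y - {v}"
      by blast
    then show ?thesis
      using card_mono[of "adj_resolving_set G x y - {v}" "{a, b}"] finite_adj_resolving_set by simp
  qed
  have "1 \<le> sum ?g (adj_resolving_set G x y)"
    if "x \<in> pverts G" "y \<in> pverts G" "x \<noteq> y" for x y
    unfolding g[OF finite_adj_resolving_set] using two[OF that] by simp
  then have "Sd_f G (complement_graph G) \<le> sum ?g (pverts G)"
    by (intro Sd_f_le_adjI) auto
  also have "\<dots> = real (card (pverts G - {v})) / 2"
    by (rule g) (rule pair_finite_verts)
  also have "\<dots> < real (card (pverts G)) / 2"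
    using card_Diff1_less[OF pair_finite_verts v] by simp
  finally show ?thesis .
qed

lemma Sd_f_eq_half_card_iff:
  "Sd_f G (complement_graph G) = real (card (pverts G)) / 2 \<longleftrightarrow>
    (\<forall>v \<in> pverts G. \<exists>C \<in> twin_classes G. v \<in> C \<and> 2 \<le> card C)"
proof
  assume eq: "Sd_f G (complement_graph G) = real (card (pverts G)) / 2"
  have equiv: "equiv (pverts G) (twin_rel G)"
    by (rule equiv_twin_rel) unfold_locales
  show "\<forall>v \<in> pverts G. \<exists>C \<in> twin_classes G. v \<in> C \<and> 2 \<le> card C"
  proof
    fix v assume v: "v \<in> pverts G"
    then obtain y where y: "(v, y) \<in> twin_rel G" "y \<noteq> v"
      using Sd_f_less_half_card_if_twinless[OF v] eq by auto
    let ?C = "twin_rel G `` {v}"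
    have "?C \<in> twin_classes G" "v \<in> ?C"
      using v equiv_class_self[OF equiv v] by (simp_all add: twin_classes_def quotientI)
    moreover have "finite ?C"
      by (rule finite_subset[OF _ pair_finite_verts]) (auto simp: twin_rel_def)
    then have "2 \<le> card ?C"
      using card_mono[of ?C "{v, y}"] y \<open>v \<in> ?C\<close> by simp
    ultimately show "\<exists>C \<in> twin_classes G. v \<in> C \<and> 2 \<le> card C" by blast
  qed
next
  assume "\<forall>v \<in> pverts G. \<exists>C \<in> twin_classes G. v \<in> C \<and> 2 \<le> card C"
  then show "Sd_f G (complement_graph G) = real (card (pverts G)) / 2"
    using Sd_f_le_half_card Sd_f_ge_half_card_if_twins by (simp add: order_antisym)
qed

end

theorem theorem3p4:
  fixes G :: "'a pair_pre_digraph" and n :: nat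
  assumes "pair_graph G"
    and "card (pverts G) = n"
    and "n \<ge> 2"
  shows "(Sd_f G (complement_graph G) = 1 \<longleftrightarrow>
            digraph_iso (with_proj G) (with_proj (path_graph 2)) \<or>
            digraph_iso (with_proj G) (with_proj (complement_graph (path_graph 2))) \<or>
            digraph_iso (with_proj G) (with_proj (path_graph 3)) \<or>
            digraph_iso (with_proj G) (with_proj (complement_graph (path_graph 3))))
       \<and> (Sd_f G (complement_graph G) = real n / 2 \<longleftrightarrow>
            (\<forall>v \<in> pverts G. \<exists>C \<in> twin_classes G. v \<in> C \<and> card C \<ge> 2))"
proof -
  interpret pair_graph G by fact
  show ?thesis
    using Sd_f_eq_1_iff adj_separates_rest_iff_iso Sd_f_eq_half_card_iff assms(2,3) by auto
qed

end
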